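(* Let $n\ge 1$. For every partition $\lambda$ of $n$ other than $(n)$ and $(1,1,\dots,1)$, there exists a cyclic permutation $\sigma$ of $\{1,\dots,n\}$ (i.e. a permutation whose cycle decomposition consists of a single $n$-cycle) such that $\Gamma(P(\sigma))=\lambda$.
   Context: Permutations of $\{1,\dots,n\}$ are written as sequences $\sigma=(\sigma_1,\dots,\sigma_n)$ with $\sigma_i$ the image of $i$. For a finite sequence $\sigma$ of distinct integers, $P(\sigma)$ is the Robinson--Schensted--Knuth insertion tableau: starting from the empty tableau, the entries $\sigma_1,\sigma_2,\dots$ are inserted in order by row insertion (to insert $a$ into row $r$: if row $r$ is empty or $a$ exceeds every entry of row $r$, append $a$ at the end of row $r$ and stop; otherwise replace the leftmost entry $b>a$ of row $r$ by $a$ and insert $b$ into row $r+1$). $\Gamma(P(\sigma))$ denotes the shape of $P(\sigma)$, i.e. its list of row lengths in nonincreasing order (a partition of the length of $\sigma$). *)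

theory Defs
  imports "HOL-Combinatorics.Combinatorics"
begin

text \<open>A tableau is the list of its rows, top row first.\<close>

type_synonym 'a tableau = "'a list list"

text \<open>The second component is the entry bumped into the next row, if any.\<close>

fun row_bump :: "'a::linorder \<Rightarrow> 'a list \<Rightarrow> 'a list \<times> 'a option" where
  "row_bump a [] = ([a], None)"
| "row_bump a (b # r) =
     (if a < b then (a # r, Some b)
      else (let (r', c) = row_bump a r in (b # r', c)))"

fun tableau_insert :: "'a::linorder \<Rightarrow> 'a tableau \<Rightarrow> 'a tableau" where
  "tableau_insert a [] = [[a]]"
| "tableau_insert a (r # T) =
     (case row_bump a r of
        (r', None) \<Rightarrow> r' # T
      | (r', Some b) \<Rightarrow> r' # tableau_insert b T)"

definition insertion_tableau :: "'a::linorder list \<Rightarrow> 'a tableau" where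
  "insertion_tableau s = fold tableau_insert s []"

definition shape :: "'a tableau \<Rightarrow> nat list" where
  "shape T = map length T"

definition int_partition :: "nat \<Rightarrow> nat list \<Rightarrow> bool" where
  "int_partition n l \<longleftrightarrow> sorted_wrt (\<ge>) l \<and> (\<forall>k\<in>set l. 0 < k) \<and> sum_list l = n"

definition one_line :: "nat \<Rightarrow> (nat \<Rightarrow> nat) \<Rightarrow> nat list" where
  "one_line n p = map p [1..<Suc n]"

end

theory Submission
  imports Defs
begin

text \<open>
  A column of height h is added to the shape of a cyclic permutation of {1, ..., n} as follows:
  a value m is replaced by n + s with s = (h + 1) div 2, and the remaining values among m, n + 1, ...,
  n + h are appended in decreasing order. The new points then form a zigzag path from n + s to m that
  is inserted into the cycle in front of m, so the permutation stays cyclic for every m. For m = n and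
  h at least 2, the appended sequence adds one cell to each of the first h rows; for h = 1 this holds
  if n is not in the first row, and that property is inherited. Every shape in question arises in
  this way from shapes with two columns, and those are obtained from the one-point permutation by two
  such steps: the first (with m = 1) gives m', followed by the other values in decreasing order, and
  the second (with m = m') turns this into a decreasing word followed by another decreasing one.
\<close>

section \<open>Row insertion of decreasing words\<close>

fun row_bumps :: "'a::linorder list \<Rightarrow> 'a list \<Rightarrow> 'a list \<times> 'a list" where
  "row_bumps [] R = (R, [])"
| "row_bumps (a # as) R =
     (case row_bump a R of
        (R', None) \<Rightarrow> row_bumps as R'
      | (R', Some c) \<Rightarrow> (fst (row_bumps as R'), c # snd (row_bumps as R')))"

text \<open>A row never sees what happens below it, so a whole word can be run through the top row
  first; the rows below then receive the word of bumped entries.\<close>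

lemma fold_tableau_insert_Cons:
  "fold tableau_insert bs (R # T) =
     fst (row_bumps bs R) # fold tableau_insert (snd (row_bumps bs R)) T"
proof (induction bs arbitrary: R T)
  case (Cons a bs)
  then show ?case by (cases "row_bump a R"; cases "snd (row_bump a R)") auto
qed simp

lemma row_bump_append: "\<forall>y\<in>set R. y < a \<Longrightarrow> row_bump a R = (R @ [a], None)"
  by (induction R) auto

lemma row_bump_Some:
  assumes "sorted S" "a \<in> set S" "b < a"
  shows "\<exists>S' c. row_bump b S = (S', Some c) \<and> length S' = length S \<and> b \<in> set S' \<and>
           set S' \<subseteq> insert b (set S) \<and> sorted S' \<and> b < c \<and> c \<le> a \<and> c \<in> set S"
  using assms
proof (induction S)
  case Nil
  then show ?case by simp
next
  case (Cons x S)
  show ?case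
  proof (cases "b < x")
    case True
    with Cons.prems show ?thesis by auto
  next
    case False
    with Cons.prems have "a \<in> set S" by auto
    with Cons obtain S' c where S': "row_bump b S = (S', Some c)" "length S' = length S" "b \<in> set S'"
        "set S' \<subseteq> insert b (set S)" "sorted S'" "b < c" "c \<le> a" "c \<in> set S"
      by auto
    moreover have "sorted (x # S')" using False S'(4,5) Cons.prems(1) by auto
    ultimately show ?thesis using False by auto
  qed
qed

text \<open>Each letter b stays in the row until the next, smaller letter arrives; that letter must
  therefore bump, and what it bumps is at most b. Since b itself bumped something larger than b, the
  bumped word is again decreasing.\<close>

lemma row_bumps_below:
  assumes "sorted S" "a \<in> set S" "sorted_wrt (>) (a # bs)"
  shows "length (fst (row_bumps bs S)) = length S \<and>
     list_all2 (<) bs (snd (row_bumps bs S)) \<and>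
     sorted_wrt (>) (snd (row_bumps bs S)) \<and>
     (\<forall>c\<in>set (snd (row_bumps bs S)). c \<le> a) \<and>
     set (snd (row_bumps bs S)) \<subseteq> set S \<union> set bs"
  using assms
proof (induction bs arbitrary: S a)
  case Nil
  then show ?case by simp
next
  case (Cons b bs)
  obtain S' c where S': "row_bump b S = (S', Some c)" "length S' = length S" "b \<in> set S'"
      "set S' \<subseteq> insert b (set S)" "sorted S'" "b < c" "c \<le> a" "c \<in> set S"
    using row_bump_Some[of S a b] Cons.prems by auto
  have "sorted_wrt (>) (b # bs)" "b < a" using Cons.prems by auto
  with Cons.IH[of S' b] S' show ?case by fastforce
qed

text \<open>The first letter is appended and then serves as the entry \<open>a\<close> of
  \<open>row_bumps_below\<close>, so the row gains exactly one cell and the word loses exactly one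
  letter on its way down.\<close>

lemma row_bumps_append:
  assumes "sorted R" "sorted_wrt (>) (a # as)" "\<forall>y\<in>set R. y < a"
  shows "length (fst (row_bumps (a # as) R)) = Suc (length R)"
    and "list_all2 (<) as (snd (row_bumps (a # as) R))"
    and "sorted_wrt (>) (snd (row_bumps (a # as) R))"
    and "\<forall>c\<in>set (snd (row_bumps (a # as) R)). c \<le> a"
    and "set (snd (row_bumps (a # as) R)) \<subseteq> set R \<union> set (a # as)"
proof -
  have "sorted (R @ [a])" using assms by (auto simp: sorted_append)
  then show "length (fst (row_bumps (a # as) R)) = Suc (length R)"
    "list_all2 (<) as (snd (row_bumps (a # as) R))"
    "sorted_wrt (>) (snd (row_bumps (a # as) R))"
    "\<forall>c\<in>set (snd (row_bumps (a # as) R)). c \<le> a"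
    "set (snd (row_bumps (a # as) R)) \<subseteq> set R \<union> set (a # as)"
    using row_bumps_below[of "R @ [a]" a as] assms(2) row_bump_append[OF assms(3)] by auto
qed

text \<open>Once the first letter is appended, each later one bumps its predecessor from the end of
  the row, and only the last letter stays.\<close>

lemma row_bumps_butlast:
  assumes "\<forall>y\<in>set R. \<forall>b\<in>set bs. y < b" "sorted_wrt (>) bs" "bs \<noteq> []"
  shows "row_bumps bs R = (R @ [last bs], butlast bs)"
proof -
  have bump: "row_bump b (R @ [c]) = (R @ [b], Some c)" if "b < c" "\<forall>y\<in>set R. y < b" for b c
    using that by (induction R) auto
  have "row_bumps as (R @ [a]) = (R @ [last (a # as)], butlast (a # as))"
    if "\<forall>y\<in>set R. \<forall>b\<in>set as. y < b" "sorted_wrt (>) (a # as)" for a as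
    using that by (induction as arbitrary: a) (auto simp: bump)
  with assms show ?thesis
    by (cases bs) (auto simp: row_bump_append)
qed

text \<open>On partitions this adds the part h to the conjugate partition, so columns may be added
  in any order.\<close>

fun add_column :: "nat \<Rightarrow> nat list \<Rightarrow> nat list" where
  "add_column 0 l = l"
| "add_column (Suc h) [] = 1 # add_column h []"
| "add_column (Suc h) (k # l) = Suc k # add_column h l"

text \<open>The exceptional entry x can be bumped in place of an element of bs, but at most once;
  below its row the inserted entries exceed everything they meet.\<close>

lemma shape_insert_column:
  assumes "sorted_wrt (>) bs" "\<forall>R\<in>set T. sorted R" "distinct (concat T)"
    and "\<forall>y\<in>set (concat T). y = x \<or> (\<forall>b\<in>set bs. y < b)"
    and "x \<in> set (concat T) \<Longrightarrow> bs \<noteq> [] \<Longrightarrow> x < hd bs"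
  shows "shape (fold tableau_insert bs T) = add_column (length bs) (shape T)"
  using assms
proof (induction "length bs" arbitrary: bs T)
  case 0
  then show ?case by simp
next
  case (Suc h)
  obtain a as where bs: "bs = a # as" using Suc.hyps(2) by (cases bs) auto
  \<comment> \<open>An empty tableau counts as an empty top row over nothing, so that opening a new
    row needs no separate case.\<close>
  define R T' where "R = (if T = [] then [] else hd T)" and "T' = tl T"
  define os where "os = snd (row_bumps bs R)"
  have T: "T = [] \<and> R = [] \<and> T' = [] \<or> T = R # T'" unfolding R_def T'_def by auto
  have fold: "fold tableau_insert bs T = fst (row_bumps bs R) # fold tableau_insert os T'"
    using T fold_tableau_insert_Cons[of bs R T'] unfolding bs os_def by auto
  have "\<forall>y\<in>set (concat T). y < a"
    using Suc.prems(4,5) unfolding bs by force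
  then have R: "sorted R" "\<forall>y\<in>set R. y < a"
    using T Suc.prems(2) by auto
  note bumps = row_bumps_append[OF R(1) Suc.prems(1)[unfolded bs] R(2), folded bs, folded os_def]
  have len: "length os = length as" using bumps(2) by (simp add: list_all2_lengthD)
  have above: "\<exists>b\<in>set as. b < c" if "c \<in> set os" for c
    using bumps(2) that by (metis in_set_conv_nth list_all2_conv_all_nth)
  have IH: "shape (fold tableau_insert os T') = add_column (length os) (shape T')"
  proof (rule Suc.hyps(1))
    show "h = length os" using Suc.hyps(2) bs len by simp
    show "sorted_wrt (>) os" by (rule bumps(3))
    show "\<forall>R\<in>set T'. sorted R" "distinct (concat T')" using T Suc.prems by auto
    \<comment> \<open>Each letter of \<open>os\<close> exceeds some letter of \<open>bs\<close>, so
      the entries other than \<open>x\<close> stay below the word.\<close>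
    show "\<forall>y\<in>set (concat T'). y = x \<or> (\<forall>b\<in>set os. y < b)"
    proof (intro ballI disjCI)
      fix y c assume "y \<in> set (concat T')" "\<not> (\<forall>b\<in>set os. y < b)"
      then obtain c where c: "c \<in> set os" "\<not> y < c" by blast
      from above[OF c(1)] obtain b where "b \<in> set as" "b < c" by blast
      moreover have "y \<in> set (concat T)" using \<open>y \<in> set (concat T')\<close> T by auto
      ultimately show "y = x" using Suc.prems(4) bs c(2) by force
    qed
    \<comment> \<open>If \<open>x\<close> lies below \<open>R\<close>, all of \<open>R\<close> is
      smaller than the letters of \<open>bs\<close>, so \<open>os\<close> again starts with
      \<open>a\<close>, which exceeds \<open>x\<close>. If \<open>x\<close> lies in
      \<open>R\<close>, distinctness keeps it out of \<open>T'\<close>.\<close>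
    show "x < hd os" if x: "x \<in> set (concat T')" and "os \<noteq> []"
    proof -
      have "x \<in> set (concat T)" "x \<notin> set R" using x T Suc.prems(3) by force+
      have "x < a" using \<open>x \<in> set (concat T)\<close> Suc.prems(5) bs by auto
      have "set R \<subseteq> set (concat T)" using T by auto
      then have R_less: "\<forall>y\<in>set R. \<forall>b\<in>set bs. y < b"
        using Suc.prems(4) \<open>x \<notin> set R\<close> by (metis subsetD)
      then have "os = butlast bs"
        using row_bumps_butlast[of R bs] Suc.prems(1) bs by (simp add: os_def)
      with \<open>os \<noteq> []\<close> \<open>x < a\<close> show ?thesis by (auto simp: bs split: if_splits)
    qed
  qed
  have "shape (fold tableau_insert bs T) = Suc (length R) # shape (fold tableau_insert os T')"
    unfolding fold using bumps(1) by (simp add: shape_def)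
  also have "\<dots> = add_column (length bs) (shape T)"
    using T unfolding IH len bs by (auto simp: shape_def)
  finally show ?case .
qed

section \<open>Invariants of insertion: content, sorted rows, order-preserving relabelling\<close>

lemma mset_row_bump:
  "mset (fst (row_bump a R)) + (case snd (row_bump a R) of None \<Rightarrow> {#} | Some c \<Rightarrow> {#c#}) =
     add_mset a (mset R)"
proof (induction R)
  case (Cons x R)
  then show ?case by (cases "row_bump a R"; cases "snd (row_bump a R)") auto
qed simp

lemma mset_tableau_insert: "mset (concat (tableau_insert a T)) = add_mset a (mset (concat T))"
proof (induction T arbitrary: a)
  case (Cons R T)
  then show ?case using mset_row_bump[of a R]
    by (cases "row_bump a R"; cases "snd (row_bump a R)") auto
qed simp

lemma mset_insertion_tableau: "mset (concat (insertion_tableau w)) = mset w"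
proof -
  have "mset (concat (fold tableau_insert w T)) = mset w + mset (concat T)" for T
    by (induction w arbitrary: T) (simp_all add: mset_tableau_insert)
  then show ?thesis by (simp add: insertion_tableau_def)
qed

lemma set_row_bump: "set (fst (row_bump a R)) \<subseteq> insert a (set R)"
proof (induction R)
  case (Cons x R)
  then show ?case by (cases "row_bump a R") auto
qed simp

lemma sorted_row_bump: "sorted R \<Longrightarrow> sorted (fst (row_bump a R))"
proof (induction R)
  case (Cons x R)
  show ?case
  proof (cases "a < x")
    case True
    then show ?thesis using Cons.prems by auto
  next
    case False
    have "\<forall>y\<in>set (fst (row_bump a R)). x \<le> y"
      using set_row_bump[of a R] False Cons.prems by auto
    then show ?thesis using False Cons by (cases "row_bump a R") auto
  qed
qed simp

lemma sorted_tableau_insert: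
  "\<forall>R\<in>set T. sorted R \<Longrightarrow> \<forall>R\<in>set (tableau_insert a T). sorted R"
proof (induction T arbitrary: a)
  case (Cons R T)
  then show ?case using sorted_row_bump[of R a]
    by (cases "row_bump a R"; cases "snd (row_bump a R)") auto
qed simp

lemma sorted_insertion_tableau: "\<forall>R\<in>set (insertion_tableau w). sorted R"
proof -
  have "\<forall>R\<in>set (fold tableau_insert w T). sorted R" if "\<forall>R\<in>set T. sorted R" for T
    using that
  proof (induction w arbitrary: T)
    case (Cons a w)
    then show ?case using sorted_tableau_insert[of T a] by simp
  qed simp
  from this[of "[]"] show ?thesis by (simp add: insertion_tableau_def)
qed

lemma row_bump_map:
  "strict_mono f \<Longrightarrow> row_bump (f a) (map f R) = map_prod (map f) (map_option f) (row_bump a R)"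
proof (induction R)
  case (Cons x R)
  then show ?case by (cases "row_bump a R") (auto simp: strict_mono_less)
qed simp

lemma tableau_insert_map:
  "strict_mono f \<Longrightarrow> tableau_insert (f a) (map (map f) T) = map (map f) (tableau_insert a T)"
proof (induction T arbitrary: a)
  case (Cons R T)
  then show ?case
    by (cases "row_bump a R"; cases "snd (row_bump a R)") (auto simp: row_bump_map)
qed simp

lemma insertion_tableau_map:
  assumes "strict_mono f"
  shows "insertion_tableau (map f w) = map (map f) (insertion_tableau w)"
proof -
  have "fold tableau_insert (map f w) (map (map f) T) = map (map f) (fold tableau_insert w T)" for T
    by (induction w arbitrary: T) (simp_all add: tableau_insert_map[OF assms])
  from this[of "[]"] show ?thesis by (simp add: insertion_tableau_def)
qed

text \<open>Every new letter is the smallest so far and pushes the whole column down by one.\<close>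

lemma insertion_tableau_decreasing:
  "sorted_wrt (>) w \<Longrightarrow> insertion_tableau w = map (\<lambda>x. [x]) (rev w)"
proof (induction w rule: rev_induct)
  case (snoc a w)
  have "tableau_insert a (map (\<lambda>x. [x]) ys) = map (\<lambda>x. [x]) (a # ys)"
    if "sorted_wrt (<) (a # ys)" for ys
    using that by (induction ys arbitrary: a) auto
  from this[of "rev w"] snoc show ?case
    by (simp add: insertion_tableau_def sorted_wrt_append sorted_wrt_rev)
qed (simp add: insertion_tableau_def)

section \<open>Inserting a zigzag path into a cycle\<close>

text \<open>For m at most n, the values at j = 1, ..., h are the elements of m, n + 1, ..., n + h other
  than n + (h + 1) div 2, in decreasing order.\<close>

definition zigzag :: "nat \<Rightarrow> nat \<Rightarrow> nat \<Rightarrow> nat \<Rightarrow> nat" where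
  "zigzag n m h j = (if j \<le> h div 2 then n + h + 1 - j else if j < h then n + h - j else m)"

definition extend :: "nat \<Rightarrow> nat \<Rightarrow> nat \<Rightarrow> (nat \<Rightarrow> nat) \<Rightarrow> nat \<Rightarrow> nat" where
  "extend n m h \<sigma> p =
     (if p \<in> {1..n} then if \<sigma> p = m then n + (h + 1) div 2 else \<sigma> p
      else if p \<in> {n+1..n+h} then zigzag n m h (p - n) else p)"

lemma extend_permutes:
  assumes "\<sigma> permutes {1..n}" "m \<in> {1..n}" "h \<ge> 1"
  shows "extend n m h \<sigma> permutes {1..n+h}"
proof (rule bij_imp_permutes)
  let ?e = "extend n m h \<sigma>"
  have \<sigma>: "1 \<le> \<sigma> p \<and> \<sigma> p \<le> n" if "1 \<le> p" "p \<le> n" for p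
    using permutes_in_image[OF assms(1), of p] that by auto
  have inj: "\<sigma> p = \<sigma> q \<Longrightarrow> p = q" for p q
    using permutes_inj[OF assms(1)] by (auto dest: injD)
  obtain t where t: "h div 2 = t" "(h + 1) div 2 + t = h" "h = 2 * t \<or> h = 2 * t + 1" by force
  have m: "1 \<le> m" "m \<le> n" using assms(2) by auto
  \<comment> \<open>\<open>low\<close> and \<open>high\<close> give the values in additive form,
    free of truncated subtraction, so that linear arithmetic can compare them. The value replacing m
    is n + h - t.\<close>
  have low: "\<sigma> p = m \<and> ?e p + t = n + h \<or> \<sigma> p \<noteq> m \<and> ?e p = \<sigma> p \<and> 1 \<le> ?e p \<and> ?e p \<le> n"
    if "1 \<le> p" "p \<le> n" for p
    using that \<sigma>[OF that] t(2) by (simp add: extend_def)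
  \<comment> \<open>The first branch takes the values above n + h - t, the second those from n + 1
    to n + h - t - 1; the gap is the value that replaces m.\<close>
  have high: "p \<le> n + t \<and> ?e p + p = 2 * n + h + 1 \<or>
      n + t < p \<and> p < n + h \<and> ?e p + p = 2 * n + h \<or> p = n + h \<and> ?e p = m"
    if "n < p" "p \<le> n + h" for p
    using that t(1) by (auto simp: extend_def zigzag_def)
  have into: "?e p \<in> {1..n+h}" if "p \<in> {1..n+h}" for p
  proof (cases "p \<le> n")
    case True
    have "1 \<le> p" using that by simp
    then have "1 \<le> ?e p \<and> ?e p \<le> n + h" using low[of p] True t(3) assms(3) by linarith
    then show ?thesis by simp
  next
    case False
    have "p \<le> n + h" using that by simp
    then have "1 \<le> ?e p \<and> ?e p \<le> n + h" using high[of p] False m by linarith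
    then show ?thesis by simp
  qed
  have sep: "?e p \<noteq> ?e q" if "1 \<le> p" "p \<le> n" "n < q" "q \<le> n + h" for p q
    using low[OF that(1,2)] high[OF that(3,4)] that t(3) m by linarith
  have "inj_on ?e {1..n+h}"
  proof (rule inj_onI)
    fix p q assume pq: "p \<in> {1..n+h}" "q \<in> {1..n+h}" "?e p = ?e q"
    consider "p \<le> n" "q \<le> n" | "p \<le> n" "n < q" | "n < p" "q \<le> n" | "n < p" "n < q" by linarith
    then show "p = q"
    proof cases
      case 1
      have "1 \<le> p" "1 \<le> q" using pq by auto
      then have "\<sigma> p = \<sigma> q" using low[of p] low[of q] 1 pq(3) t(3) assms(3) by linarith
      then show ?thesis by (rule inj)
    next
      case 2
      then show ?thesis using sep[of p q] pq by simp
    next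
      case 3
      then show ?thesis using sep[of q p] pq by simp
    next
      case 4
      have "p \<le> n + h" "q \<le> n + h" using pq by auto
      then show ?thesis using high[of p] high[of q] 4 pq(3) m by linarith
    qed
  qed
  moreover from this have "?e ` {1..n+h} = {1..n+h}"
    using into by (intro endo_inj_surj image_subsetI) simp_all
  ultimately show "bij_betw ?e {1..n+h} {1..n+h}" by (simp only: bij_betw_def)
  show "?e p = p" if "p \<notin> {1..n+h}" for p using that by (auto simp: extend_def)
qed

text \<open>Orbits of a permutation of a finite set are cycles, so reachability is symmetric and it
  suffices to follow paths towards m.\<close>

lemma cyclic_on_if_reaches:
  assumes "f permutes S" "finite S" "m \<in> S" "\<And>x. x \<in> S \<Longrightarrow> m \<in> orbit f x"
  shows "cyclic_on f S"
proof -
  have perm: "permutation f" using assms(1,2) permutation_permutes by blast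
  have "x \<in> orbit f m" if "x \<in> S" for x
    using orbit_cyclic_eq3[OF cyclic_on_orbit[OF assms(1,2)] assms(4)[OF that]]
      permutation_self_in_orbit[OF perm, of x] by simp
  then have "S = orbit f m"
    using assms(1,3) by (auto dest: permutes_orbit_subset)
  then show ?thesis using assms(3) by (auto simp: cyclic_on_def)
qed

text \<open>Among the new points the path is forced: a position n + j with j small goes to
  n + h + 1 - j and from there to n + (j - 1), until it leaves through m.\<close>

lemma extend_cyclic_on:
  assumes "\<sigma> permutes {1..n}" "cyclic_on \<sigma> {1..n}" "m \<in> {1..n}" "h \<ge> 1"
  shows "cyclic_on (extend n m h \<sigma>) {1..n+h}"
proof (rule cyclic_on_if_reaches)
  let ?f = "extend n m h \<sigma>"
  show "?f permutes {1..n+h}" using extend_permutes assms by blast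
  show "m \<in> {1..n+h}" using assms(3) by simp
  have orbitI: "m \<in> orbit ?f x" if "?f x = y" "y = m \<or> m \<in> orbit ?f y" for x y
    using that orbit.base[of "?f" x] orbit_subset[of m "?f" x] by auto
  have small: "m \<in> orbit ?f (n + j)" if "1 \<le> j" "j \<le> h div 2" for j
    using that
  proof (induction j rule: nat_induct_at_least)
    case base
    have "?f (n + 1) = n + h" "?f (n + h) = m"
      using base assms(4) by (auto simp: extend_def zigzag_def)
    then show ?case by (blast intro: orbitI)
  next
    case (Suc j)
    have "?f (n + Suc j) = n + (h - j)" "?f (n + (h - j)) = n + j"
      using Suc.hyps Suc.prems by (auto simp: extend_def zigzag_def)
    moreover have "m \<in> orbit ?f (n + j)" using Suc by simp
    ultimately show ?case by (blast intro: orbitI)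
  qed
  have new: "m \<in> orbit ?f (n + j)" if j: "1 \<le> j" "j \<le> h" for j
  proof (cases "j \<le> h div 2")
    case True
    then show ?thesis using small j by blast
  next
    case False
    show ?thesis
    proof (cases "j = h")
      case True
      then have "?f (n + j) = m" using False j by (auto simp: extend_def zigzag_def)
      then show ?thesis by (blast intro: orbitI)
    next
      case jh: False
      \<comment> \<open>Here h div 2 < j < h, so h - j falls into the range of
        \<open>small\<close>.\<close>
      have "?f (n + j) = n + (h - j)" using False j jh by (auto simp: extend_def zigzag_def)
      moreover have "m \<in> orbit ?f (n + (h - j))" using False j jh by (intro small) auto
      ultimately show ?thesis by (blast intro: orbitI)
    qed
  qed
  \<comment> \<open>\<open>?f\<close> follows \<open>\<sigma>\<close> on old points except where
    \<open>\<sigma>\<close> would reach m; there it enters the new points, and these lead to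
    m.\<close>
  have step: "m \<in> orbit ?f x" if x: "x \<in> {1..n}" "\<sigma> x = m \<or> m \<in> orbit ?f (\<sigma> x)" for x
  proof (cases "\<sigma> x = m")
    case True
    then have "?f x = n + (h + 1) div 2" using x by (simp add: extend_def)
    moreover have "m \<in> orbit ?f (n + (h + 1) div 2)" using assms(4) by (intro new) auto
    ultimately show ?thesis by (blast intro: orbitI)
  next
    case False
    then have "?f x = \<sigma> x" using x by (simp add: extend_def)
    then show ?thesis using False x by (blast intro: orbitI)
  qed
  have "m \<in> orbit ?f x" if "x \<in> {1..n}" for x
  proof -
    have "m \<in> orbit \<sigma> x" using assms(2,3) that by (metis orbit_cyclic_eq3)
    \<comment> \<open>Induction on the number of \<open>\<sigma>\<close>-steps to m; it is a
      successor because an orbit begins after one application.\<close>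
    then obtain k where "m = (\<sigma> ^^ Suc k) x" by (auto simp: orbit_altdef gr0_conv_Suc)
    with that show ?thesis
    proof (induction k arbitrary: x)
      case 0
      then show ?case using step by simp
    next
      case (Suc k)
      have "\<sigma> x \<in> {1..n}" using permutes_in_image[OF assms(1)] Suc.prems(1) by blast
      then have "m \<in> orbit ?f (\<sigma> x)" using Suc.IH[of "\<sigma> x"] Suc.prems(2) by (simp add: funpow_swap1)
      then show ?case using step Suc.prems(1) by blast
    qed
  qed
  then show "m \<in> orbit ?f x" if "x \<in> {1..n+h}" for x
    using that new[of "x - n"] by (cases "x \<le> n") auto
qed simp

section \<open>One-line words of extended cycles and the growth of their shapes\<close>

declare upt_Suc [simp del]

lemma one_line_extend:
  "one_line (n + h) (extend n m h \<sigma>) =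
     map (\<lambda>v. if v = m then n + (h + 1) div 2 else v) (one_line n \<sigma>) @ map (zigzag n m h) [1..<Suc h]"
proof (rule nth_equalityI)
  fix i assume "i < length (one_line (n + h) (extend n m h \<sigma>))"
  then show "one_line (n + h) (extend n m h \<sigma>) ! i =
      (map (\<lambda>v. if v = m then n + (h + 1) div 2 else v) (one_line n \<sigma>) @ map (zigzag n m h) [1..<Suc h]) ! i"
    by (auto simp: one_line_def nth_append extend_def Suc_diff_le)
qed (simp add: one_line_def)

lemma zigzag_decreasing:
  assumes "m \<le> n"
  shows "sorted_wrt (>) (map (zigzag n m h) [1..<Suc h])"
  unfolding sorted_wrt_iff_nth_less using assms
  by (auto simp: zigzag_def)

definition realizes :: "nat \<Rightarrow> (nat \<Rightarrow> nat) \<Rightarrow> nat list \<Rightarrow> bool" where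
  "realizes n \<sigma> l \<longleftrightarrow> n \<ge> 1 \<and> \<sigma> permutes {1..n} \<and> cyclic_on \<sigma> {1..n} \<and>
     shape (insertion_tableau (one_line n \<sigma>)) = l"

text \<open>Counting cells. Constructions may thus leave the size existential; it is recovered from
  the list at the end.\<close>

lemma realizes_sum_list:
  assumes "realizes n \<sigma> l"
  shows "sum_list l = n"
proof -
  have "sum_list l = length (concat (insertion_tableau (one_line n \<sigma>)))"
    using assms by (auto simp: realizes_def shape_def length_concat)
  also have "\<dots> = length (one_line n \<sigma>)"
    by (metis mset_insertion_tableau size_mset)
  finally show ?thesis by (simp add: one_line_def)
qed

lemma set_one_line:
  assumes "\<sigma> permutes {1..n}"
  shows "set (one_line n \<sigma>) = {1..n}"
proof -
  have "{1..<Suc n} = {1..n}" by auto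
  then show ?thesis unfolding one_line_def set_map set_upt using permutes_image[OF assms] by simp
qed

lemma distinct_one_line:
  assumes "\<sigma> permutes {1..n}"
  shows "distinct (one_line n \<sigma>)"
  unfolding one_line_def distinct_map using permutes_inj_on[OF assms] distinct_upt by blast

lemma set_zigzag_ge: "m \<le> n \<Longrightarrow> v \<in> set (map (zigzag n m h) [1..<Suc h]) \<Longrightarrow> m \<le> v"
  by (auto simp: zigzag_def)

text \<open>Replacing the value n by n + s with s > 0 does not change the relative order of 1, ..., n.\<close>

lemma insertion_tableau_extend_max:
  fixes n h :: nat
  assumes "\<sigma> permutes {1..n}"
  defines "f \<equiv> \<lambda>v. if v < n then v else v + (h + 1) div 2"
  shows "strict_mono f"
    and "insertion_tableau (one_line (n + h) (extend n n h \<sigma>)) =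
      fold tableau_insert (map (zigzag n n h) [1..<Suc h])
        (map (map f) (insertion_tableau (one_line n \<sigma>)))"
proof -
  show mono: "strict_mono f" by (auto simp: f_def strict_mono_def)
  have "map (\<lambda>v. if v = n then n + (h + 1) div 2 else v) (one_line n \<sigma>) = map f (one_line n \<sigma>)"
    using set_one_line[OF assms(1)] by (auto simp: f_def)
  then show "insertion_tableau (one_line (n + h) (extend n n h \<sigma>)) =
      fold tableau_insert (map (zigzag n n h) [1..<Suc h])
        (map (map f) (insertion_tableau (one_line n \<sigma>)))"
    unfolding one_line_extend insertion_tableau_map[OF mono, symmetric]
    by (simp only: insertion_tableau_def fold_append comp_apply)
qed

text \<open>Relabelling raises the maximum n to n + (h + 1) div 2. The other entries are below n,
  the least appended letter, so the raised one is the exceptional entry of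
  \<open>shape_insert_column\<close>.\<close>

lemma realizes_add_column:
  assumes "realizes n \<sigma> l" "h \<ge> 2"
  shows "realizes (n + h) (extend n n h \<sigma>) (add_column h l)"
proof -
  have \<sigma>: "n \<ge> 1" "\<sigma> permutes {1..n}" "cyclic_on \<sigma> {1..n}"
    and l: "shape (insertion_tableau (one_line n \<sigma>)) = l"
    using assms(1) by (auto simp: realizes_def)
  define f where "f = (\<lambda>v. if v < n then v else v + (h + 1) div 2)"
  define P where "P = insertion_tableau (one_line n \<sigma>)"
  let ?bs = "map (zigzag n n h) [1..<Suc h]"
  note ext = insertion_tableau_extend_max[OF \<sigma>(2), where h = h, folded f_def, folded P_def]
  have P: "mset (concat P) = mset (one_line n \<sigma>)"
    by (simp add: P_def mset_insertion_tableau)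
  have setP: "set (concat P) = {1..n}"
    using P set_one_line[OF \<sigma>(2)] by (metis set_mset_mset)
  have "shape (fold tableau_insert ?bs (map (map f) P)) = add_column (length ?bs) (shape (map (map f) P))"
  proof (rule shape_insert_column[where x = "n + (h + 1) div 2"])
    show "sorted_wrt (>) ?bs" by (rule zigzag_decreasing) simp
    show "\<forall>R\<in>set (map (map f) P). sorted R"
    proof -
      have "sorted (map f R)" if "sorted R" for R
        using that by (induction R) (auto simp: strict_mono_less_eq[OF ext(1)])
      then show ?thesis using sorted_insertion_tableau[of "one_line n \<sigma>"] by (simp add: P_def)
    qed
    have "distinct (concat P)"
      using P distinct_one_line[OF \<sigma>(2)] by (metis mset_eq_imp_distinct_iff)
    then show "distinct (concat (map (map f) P))"
      unfolding map_concat[symmetric] distinct_map using strict_mono_on_imp_inj_on[OF ext(1)]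
      by (blast intro: inj_on_subset)
    show "\<forall>y\<in>set (concat (map (map f) P)). y = n + (h + 1) div 2 \<or> (\<forall>b\<in>set ?bs. y < b)"
    proof
      fix y assume "y \<in> set (concat (map (map f) P))"
      then obtain v where "v \<in> {1..n}" "y = f v" unfolding map_concat[symmetric] set_map setP by blast
      then have "y = n + (h + 1) div 2 \<or> y < n" by (auto simp: f_def)
      then show "y = n + (h + 1) div 2 \<or> (\<forall>b\<in>set ?bs. y < b)"
        using set_zigzag_ge[of n n _ h] by (meson order_refl less_le_trans)
    qed
    \<comment> \<open>This needs h \<ge> 2: for h = 1 the raised value n + 1 exceeds the only
      appended letter n.\<close>
    have "hd ?bs = n + h" using assms(2) by (simp add: upt_conv_Cons zigzag_def)
    then show "n + (h + 1) div 2 < hd ?bs" using assms(2) by linarith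
  qed
  then have "shape (insertion_tableau (one_line (n + h) (extend n n h \<sigma>))) = add_column h l"
    using ext(2) l by (simp add: P_def shape_def comp_def)
  then show ?thesis
    using extend_permutes[OF \<sigma>(2), of n h] extend_cyclic_on[OF \<sigma>(2,3), of n h] \<sigma>(1) assms(2)
    by (simp add: realizes_def)
qed

text \<open>The raised maximum n + 1 lies below the first row, so the appended letter n exceeds that
  whole row and bumps nothing. The new maximum is still outside the first row, which allows
  iteration.\<close>

lemma realizes_add_box:
  assumes "realizes n \<sigma> l" "n \<notin> set (hd (insertion_tableau (one_line n \<sigma>)))"
  shows "realizes (n + 1) (extend n n 1 \<sigma>) (add_column 1 l)"
    and "n + 1 \<notin> set (hd (insertion_tableau (one_line (n + 1) (extend n n 1 \<sigma>))))"
proof -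
  have \<sigma>: "n \<ge> 1" "\<sigma> permutes {1..n}" "cyclic_on \<sigma> {1..n}"
    and l: "shape (insertion_tableau (one_line n \<sigma>)) = l"
    using assms(1) by (auto simp: realizes_def)
  define f where "f = (\<lambda>v. if v < n then v else v + (1 + 1) div 2)"
  define P where "P = insertion_tableau (one_line n \<sigma>)"
  note ext = insertion_tableau_extend_max(2)[OF \<sigma>(2), where h = 1, folded f_def, folded P_def]
  have setP: "set (concat P) = {1..n}"
    using set_one_line[OF \<sigma>(2)] by (metis P_def mset_insertion_tableau set_mset_mset)
  then have "P \<noteq> []" using \<sigma>(1) by auto
  then obtain R T where RT: "P = R # T" by (cases P) auto
  have R: "v < n" if "v \<in> set R" for v
  proof -
    have "v \<in> {1..n}" "v \<noteq> n" using that setP RT assms(2) by (auto simp: P_def[symmetric])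
    then show ?thesis by simp
  qed
  then have "map f R = R" by (simp add: f_def map_idI)
  then have P': "insertion_tableau (one_line (n + 1) (extend n n 1 \<sigma>)) = (R @ [n]) # map (map f) T"
    using ext RT row_bump_append[of R n] R by (simp add: zigzag_def upt_Suc)
  then show "n + 1 \<notin> set (hd (insertion_tableau (one_line (n + 1) (extend n n 1 \<sigma>))))"
    using R by force
  have "shape (insertion_tableau (one_line (n + 1) (extend n n 1 \<sigma>))) = add_column 1 l"
    using P' l RT by (auto simp: P_def[symmetric] shape_def comp_def)
  then show "realizes (n + 1) (extend n n 1 \<sigma>) (add_column 1 l)"
    using extend_permutes[OF \<sigma>(2), of n 1] extend_cyclic_on[OF \<sigma>(2,3), of n 1] \<sigma>(1)
    by (simp add: realizes_def)
qed

section \<open>Two-column shapes, hooks and general shapes\<close>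

lemma add_column_replicate_commute:
  "add_column a (replicate b 1) = add_column b (replicate a 1)"
proof (induction a arbitrary: b)
  case 0
  show ?case by (induction b) auto
next
  case (Suc a)
  have "add_column b [] = replicate b 1" for b by (induction b) auto
  with Suc show ?case by (cases b) auto
qed

text \<open>A single column comes only from the reversal, which is not cyclic for a \<ge> 3. So a
  cyclic word \<open>m # ds\<close> with \<open>ds\<close> decreasing is taken; the second extension
  raises m to \<open>x\<close>, which makes the prefix a column of height a, and appends the letters
  of the other column.\<close>

lemma two_columns:
  assumes "2 \<le> a" "1 \<le> b"
  obtains \<sigma> where "realizes (a + b) \<sigma> (add_column b (replicate a 1))"
    and "a + b \<notin> set (hd (insertion_tableau (one_line (a + b) \<sigma>)))"
proof -
  \<comment> \<open>This is the value that the first extension puts at position 1.\<close>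
  define m where "m = a div 2 + 1"
  define \<sigma> where "\<sigma> = extend 1 1 (a - 1) id"
  define x where "x = a + (b + 1) div 2"
  define ds where "ds = map (zigzag 1 1 (a - 1)) [1..<a]"
  have id: "id permutes {1..1::nat}" "cyclic_on id {1..1::nat}"
    by (auto simp: permutes_id cyclic_on_def orbit_altdef intro!: exI[of _ 1])
  have a: "1 + (a - 1) = a" "Suc (a - 1) = a" using assms by auto
  have \<sigma>: "\<sigma> permutes {1..a}" "cyclic_on \<sigma> {1..a}"
    using extend_permutes[OF id(1), of 1 "a - 1"] extend_cyclic_on[OF id, of 1 "a - 1"] assms(1)
    by (simp_all add: \<sigma>_def a)
  have m: "m \<in> {2..a}" using assms(1) by (auto simp: m_def)
  have m': "1 + (a - 1 + 1) div 2 = m" using assms(1) by (simp add: m_def)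
  have word: "one_line a \<sigma> = m # ds"
  proof -
    have "one_line 1 id = [1]" by (simp add: one_line_def upt_Suc)
    then show ?thesis
      using one_line_extend[of 1 "a - 1" 1 id] unfolding a m' \<sigma>_def[symmetric] ds_def by simp
  qed
  have set: "set (m # ds) = {1..a}" "distinct (m # ds)"
    using set_one_line[OF \<sigma>(1)] distinct_one_line[OF \<sigma>(1)] by (simp_all add: word)
  let ?bs = "map (zigzag a m b) [1..<Suc b]"
  let ?\<tau> = "extend a m b \<sigma>"
  have word': "one_line (a + b) ?\<tau> = (x # ds) @ ?bs"
  proof -
    have "map (\<lambda>v. if v = m then x else v) ds = ds" using set(2) by (intro map_idI) auto
    then show ?thesis unfolding one_line_extend word x_def[symmetric] by simp
  qed
  have ds: "sorted_wrt (>) ds"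
    using zigzag_decreasing[of 1 1 "a - 1"] unfolding ds_def a by simp
  have dsx: "\<forall>d\<in>set ds. d < x"
  proof
    fix d assume "d \<in> set ds"
    then have "d \<in> {1..a}" using set(1) by auto
    then show "d < x" using assms(2) by (auto simp: x_def)
  qed
  \<comment> \<open>The zigzag ends with 1, so 1 alone forms the top row of the column.\<close>
  have ne: "ds \<noteq> []" and last: "last ds = 1"
    using assms(1) by (auto simp: ds_def last_map zigzag_def)
  have rds: "rev ds = 1 # rev (butlast ds)"
    using arg_cong[OF append_butlast_last_id[OF ne], of rev] last by simp
  define T where "T = map (\<lambda>d. [d]) (rev (x # butlast ds))"
  have P: "insertion_tableau (x # ds) = [1] # T"
    using insertion_tableau_decreasing[of "x # ds"] ds dsx rds by (simp add: T_def)
  have bs: "sorted_wrt (>) ?bs" using m by (intro zigzag_decreasing) auto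
  have bs_gt: "\<forall>c\<in>set ?bs. 1 < c"
  proof
    fix c assume "c \<in> set ?bs"
    then have "m \<le> c" using m by (intro set_zigzag_ge[of m a c b]) auto
    then show "1 < c" using m by simp
  qed
  \<comment> \<open>The last appended letter m stays in the top row; only the letters before it
    travel down.\<close>
  have split: "?bs = map (zigzag a m b) [1..<b] @ [m]"
  proof -
    have "\<not> b \<le> b div 2" using assms(2) by linarith
    then show ?thesis using assms(2) by (simp add: zigzag_def upt_Suc)
  qed
  have bumps: "row_bumps ?bs [1] = ([1, last ?bs], butlast ?bs)"
    using row_bumps_butlast[of "[1]" ?bs] bs bs_gt assms(2) by simp
  have ins: "insertion_tableau (one_line (a + b) ?\<tau>) =
      [1, m] # fold tableau_insert (map (zigzag a m b) [1..<b]) T"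
  proof -
    have "insertion_tableau (one_line (a + b) ?\<tau>) = fold tableau_insert ?bs (insertion_tableau (x # ds))"
      unfolding word' by (simp add: insertion_tableau_def)
    then show ?thesis unfolding P fold_tableau_insert_Cons bumps unfolding split by simp
  qed
  have cT: "concat (map (\<lambda>d. [d]) ys) = ys" for ys :: "nat list" by (induction ys) auto
  have shT: "shape (fold tableau_insert (map (zigzag a m b) [1..<b]) T) =
      add_column (length (map (zigzag a m b) [1..<b])) (shape T)"
  proof (rule shape_insert_column[where x = x])
    show "sorted_wrt (>) (map (zigzag a m b) [1..<b])"
      using bs unfolding split by (simp add: sorted_wrt_append)
    show "\<forall>R\<in>set T. sorted R" by (auto simp: T_def)
    have "distinct ds" using set(2) by simp
    then show "distinct (concat T)"
      using dsx in_set_butlastD[of x ds] unfolding T_def cT by (auto simp: distinct_butlast)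
    \<comment> \<open>The letters sent down all exceed a, and \<open>x\<close> is the only entry of
      \<open>T\<close> above a.\<close>
    have "a < c" if "c \<in> set (map (zigzag a m b) [1..<b])" for c
      using that by (auto simp: zigzag_def)
    moreover have "y = x \<or> y \<le> a" if "y \<in> set (concat T)" for y
      using that set(1) in_set_butlastD[of y ds] unfolding T_def cT by auto
    ultimately show "\<forall>y\<in>set (concat T). y = x \<or> (\<forall>c\<in>set (map (zigzag a m b) [1..<b]). y < c)"
      by fastforce
    \<comment> \<open>For b = 1 nothing is sent down; otherwise the first letter is a + b, larger
      than \<open>x\<close>.\<close>
    assume "map (zigzag a m b) [1..<b] \<noteq> []"
    then have "b \<ge> 2" by simp
    then have "hd (map (zigzag a m b) [1..<b]) = a + b" by (simp add: upt_conv_Cons zigzag_def)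
    then show "x < hd (map (zigzag a m b) [1..<b])" using \<open>b \<ge> 2\<close> by (simp add: x_def)
  qed
  have "length ds = a - 1" by (simp add: ds_def)
  then have "shape T = replicate (a - 1) 1" using assms(1)
    by (intro replicate_eqI) (auto simp: shape_def T_def)
  then have "shape (insertion_tableau (one_line (a + b) ?\<tau>)) = 2 # add_column (b - 1) (replicate (a - 1) 1)"
    using ins shT by (simp add: shape_def)
  also have "\<dots> = add_column b (replicate a 1)"
    using assms by (cases a; cases b) auto
  finally have "realizes (a + b) ?\<tau> (add_column b (replicate a 1))"
    using extend_permutes[OF \<sigma>(1), of m b] extend_cyclic_on[OF \<sigma>, of m b] m assms(1,2)
    by (simp add: realizes_def)
  moreover have "a + b \<notin> set (hd (insertion_tableau (one_line (a + b) ?\<tau>)))"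
    unfolding ins using m assms by auto
  ultimately show thesis by (rule that)
qed

text \<open>Taking the column of height a off the hook leaves a single row, which for k \<ge> 2
  comes only from the identity, so \<open>realizes_add_column\<close> has nothing to start from. The
  hook instead grows from its two-column case, one cell of the first row at a time.\<close>

lemma hook:
  assumes "2 \<le> a" "1 \<le> k"
  shows "\<exists>n \<sigma>. realizes n \<sigma> (add_column a [k]) \<and>
           n \<notin> set (hd (insertion_tableau (one_line n \<sigma>)))"
  using assms(2)
proof (induction k rule: nat_induct_at_least)
  case base
  obtain \<sigma> where "realizes (a + 1) \<sigma> (add_column 1 (replicate a 1))"
    "a + 1 \<notin> set (hd (insertion_tableau (one_line (a + 1) \<sigma>)))"
    using two_columns[of a 1] assms(1) by auto
  moreover have "add_column 1 (replicate a 1) = add_column a [1]"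
    using add_column_replicate_commute[of 1 a] by simp
  ultimately show ?case by metis
next
  case (Suc k)
  then obtain n \<sigma> where n: "realizes n \<sigma> (add_column a [k])"
    "n \<notin> set (hd (insertion_tableau (one_line n \<sigma>)))" by blast
  have "add_column 1 (add_column a [k]) = add_column a [Suc k]"
    using assms(1) by (cases a) auto
  then show ?case
    using realizes_add_box[OF n] by (intro exI[of _ "n + 1"] exI[of _ "extend n n 1 \<sigma>"]) simp
qed

text \<open>Decrementing every row removes the first column, and emptied rows are dropped to leave a
  partition. The clause on \<open>hd\<close> provides the measure for the induction in
  \<open>realizable\<close>.\<close>

lemma remove_column:
  assumes "sorted_wrt (\<ge>) l" "\<forall>k\<in>set l. (0::nat) < k"
  obtains l' where "l = add_column (length l) l'" "sorted_wrt (\<ge>) l'" "\<forall>k\<in>set l'. 0 < k"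
    "l \<noteq> [] \<and> 1 < hd l \<longrightarrow> l' \<noteq> [] \<and> hd l' = hd l - 1"
proof -
  let ?l = "filter (\<lambda>k. 0 < k) (map (\<lambda>k. k - 1) l)"
  have Nil: "add_column n [] = replicate n 1" for n by (induction n) auto
  have "l = add_column (length l) ?l"
    using assms
  proof (induction l)
    case (Cons k l)
    show ?case
    proof (cases "k = 1")
      case True
      \<comment> \<open>Rows below a row of length 1 also have length 1, so filtering leaves
        nothing.\<close>
      then have "\<forall>j\<in>set (k # l). j = 1" using Cons.prems by force
      then have "k # l = replicate (length (k # l)) 1"
        and "filter (\<lambda>k. 0 < k) (map (\<lambda>k. k - 1) (k # l)) = []"
        by (simp_all add: replicate_length_same filter_empty_conv)
      then show ?thesis by (simp only: Nil)
    next
      case False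
      have "add_column (length l) (filter (\<lambda>k. 0 < k) (map (\<lambda>k. k - 1) l)) = l"
        using Cons.IH Cons.prems by simp
      then show ?thesis using False Cons.prems(2) by auto
    qed
  qed simp
  moreover have "sorted_wrt (\<ge>) (map (\<lambda>k. k - 1) l)"
    using assms(1) by (induction l) (auto simp: diff_le_mono)
  then have "sorted_wrt (\<ge>) ?l" by (rule sorted_wrt_filter)
  moreover have "\<forall>k\<in>set ?l. 0 < k" by simp
  moreover have "l \<noteq> [] \<and> 1 < hd l \<longrightarrow> ?l \<noteq> [] \<and> hd ?l = hd l - 1"
    by (cases l) auto
  ultimately show thesis by (rule that)
qed

text \<open>Induction on the number of columns: the first one is taken off. What remains either has
  two rows and two columns again, or is a single column, or is a single row; the last two cases are
  \<open>two_columns\<close> and \<open>hook\<close>.\<close>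

lemma realizable:
  assumes "sorted_wrt (\<ge>) l" "\<forall>k\<in>set l. 0 < k" "2 \<le> length l" "2 \<le> hd l"
  shows "\<exists>n \<sigma>. realizes n \<sigma> l"
  using assms
proof (induction "hd l" arbitrary: l rule: less_induct)
  case less
  define a where "a = length l"
  have a: "2 \<le> a" using less.prems(3) by (simp add: a_def)
  obtain l' where l': "l = add_column (length l) l'" "sorted_wrt (\<ge>) l'" "\<forall>k\<in>set l'. 0 < k"
    "l \<noteq> [] \<and> 1 < hd l \<longrightarrow> l' \<noteq> [] \<and> hd l' = hd l - 1"
    by (rule remove_column[OF less.prems(1,2)])
  have "l \<noteq> []" "1 < hd l" using less.prems(3,4) by auto
  then have "l' \<noteq> []" "hd l' = hd l - 1" using l'(4) by blast+
  note l' = l'(1)[folded a_def] l'(2,3) this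
  consider "hd l' = 1" | "2 \<le> hd l'" "length l' = 1" | "2 \<le> hd l'" "2 \<le> length l'"
  proof -
    have "1 \<le> hd l'" "1 \<le> length l'" using l'(4,5) \<open>1 < hd l\<close> by (auto simp: Suc_le_eq)
    then show thesis using that by linarith
  qed
  then show ?case
  proof cases
    case 1
    then have "l' = replicate (length l') 1" using l'(2,3,4)
      by (intro replicate_eqI) (cases l'; force)+
    \<comment> \<open>\<open>two_columns\<close> starts from the column of height a, so the two
      columns trade places.\<close>
    then have "l = add_column (length l') (replicate a 1)"
      using l'(1) add_column_replicate_commute[of a "length l'"] by metis
    moreover have "1 \<le> length l'" using l'(4) by (simp add: Suc_le_eq)
    ultimately show ?thesis using two_columns[of a "length l'"] a by metis
  next
    case 2
    then obtain k where "l' = [k]" "1 \<le> k" using l'(4) by (cases l') auto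
    then show ?thesis using hook[of a k] a l'(1) by metis
  next
    case 3
    then obtain n \<sigma> where "realizes n \<sigma> l'" using less.hyps[of l'] l'(2,3,5) 3 \<open>1 < hd l\<close> by auto
    then show ?thesis using realizes_add_column[of n \<sigma> l' a] a l'(1) by metis
  qed
qed

theorem theorem3p1:
  fixes n :: nat and l :: "nat list"
  assumes "n \<ge> 1"
    and "int_partition n l"
    and "l \<noteq> [n]"
    and "l \<noteq> replicate n 1"
  shows "\<exists>\<sigma>. \<sigma> permutes {1..n} \<and> cyclic_on \<sigma> {1..n} \<and>
           shape (insertion_tableau (one_line n \<sigma>)) = l"
proof -
  have l: "sorted_wrt (\<ge>) l" "\<forall>k\<in>set l. 0 < k" "sum_list l = n"
    using assms(2) by (auto simp: int_partition_def)
  then obtain k ks where k: "l = k # ks" using assms(1) by (cases l) auto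
  \<comment> \<open>The two excluded partitions are exactly those with a single row or a single
    column.\<close>
  have "ks \<noteq> []" using k l(3) assms(3) by auto
  then have "2 \<le> length l" using k by (cases ks) auto
  moreover have "2 \<le> hd l"
  proof (rule ccontr)
    assume "\<not> 2 \<le> hd l"
    then have "\<forall>j\<in>set l. j = 1" using k l(1,2) by force
    then have "l = replicate (length l) 1" by (simp add: replicate_length_same)
    moreover from this have "length l = n" using l(3) by (metis sum_list_replicate mult.right_neutral of_nat_id)
    ultimately show False using assms(4) by simp
  qed
  ultimately obtain n' \<sigma> where "realizes n' \<sigma> l" using realizable l by blast
  moreover from this have "n' = n" using realizes_sum_list l(3) by blast
  ultimately show ?thesis by (auto simp: realizes_def)
qed

end
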